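(* Let $y^*\in\mathbb{R}^{2n-1}$ satisfy $F(y^* )=0$, so that $[y^*]$ is the (compact, convex) solution set of $F(y)=0$. If the current iterate is sufficiently close to $[y^*]$, then the modified semismooth Newton method, with its vertex step carried out by the shifting procedure described in the context, converges, and at a Q-quadratic rate, to a point in $[y^*]$. That is: there exists $\delta>0$ such that for every starting iterate $y^0\in\mathbb{R}^{2n-1}$ with $\operatorname{dist}(y^0,[y^*])<\delta$, the sequence $\{y^k\}$ generated from $y^0$ by this method converges Q-quadratically to some point of $[y^*]$.
   Context: Fix $n\ge 1$ and $\hat X\in\mathbb{R}^{n\times n}$. $\operatorname{vec}$ stacks the columns of a matrix, $\operatorname{Mat}$ is its inverse, $\hat x=\operatorname{vec}(\hat X)$. Let $e$ be the all-ones vector in $\mathbb{R}^n$, let $A\in\mathbb{R}^{(2n-1)\times n^2}$ consist of the first $2n-1$ rows of $\begin{bmatrix} I_n\otimes e^T\\ e^T\otimes I_n\end{bmatrix}$, and let $b\in\mathbb{R}^{2n-1}$ be the all-ones vector. $v_+$ is the entrywise positive part of $v$, and $F(y)=A(\hat x+A^Ty)_+-b$ for $y\in\mathbb{R}^{2n-1}$. Equivalence classes: $y\sim y'$ iff $(\hat x+A^Ty)_+=(\hat x+A^Ty')_+$, and $[y]=\{y'\in\mathbb{R}^{2n-1}: y'\sim y\}$. Each $[y]$ is a polyhedron having at least one vertex, and if $F(y^* )=0$ then $[y^*]=\{y: F(y)=0\}$. Distance: $\operatorname{dist}(y,S)=\inf_{s\in S}\|y-s\|$. Connectedness and blocks: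 to an $n\times n$ matrix associate the bipartite graph whose nodes are its $n$ rows and $n$ columns, with an edge between row $i$ and column $j$ iff the $(i,j)$ entry is nonzero. The matrix is connected if this graph is connected, and disconnected otherwise. The blocks of a matrix are the connected components of its graph; each block has a set of rows and a set of columns, one of which may be empty. If there are $K$ blocks, they are numbered $1,\dots,K$ so that block $K$ contains row $n$. Maximal matrix: for $y\in\mathbb{R}^{2n-1}$, the maximal $M\in\{0,1\}^{n\times n}$ for $y$ has $M_{ij}=1$ if $\operatorname{Mat}(\hat x+A^Ty)_{ij}\ge 0$ and $M_{ij}=0$ otherwise; the maximal matrix of the generalized Jacobian of $F$ at $y$ is $A\,\operatorname{Diag}(\operatorname{vec}(M))A^T$. The vector $y$ is a vertex of $[y]$ if and only if its maximal $M$ is connected, and then this maximal matrix of the generalized Jacobian is nonsingular. Shifting procedure (finds a vertex of $[y]$ from $y$): let $Y=\operatorname{Mat}(\hat x+A^Ty)$, $X=Y_+$, and let $M$ be the maximal matrix for $y$. If $M$ is connected, stop and return $y$, which is a vertex. Otherwise let $1,\dots,K$ be the blocks of $X$ and choose a proper subset $\mathcal B\subset\{1,\dots,K\}$ with $K\in\mathcal B$ such that, with $R$ and $C$ the sets of all rows and all columns belonging to blocks in $\mathcal B$, and $\bar R,\bar C$ their complements in $\{1,\dots,n\}$, all entries of the submatrices $Y^{R,\bar C}$ and $Y^{\bar R,C}$ are negative (such $\mathcal B$ exists; one of these submatrices may be empty). Choose either $t=-\max_{i\in R,\,j\in\bar C}Y_{ij}>0$ or $t=\max_{i\in\bar R,\,j\in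 C}Y_{ij}<0$ (a choice being available only if the corresponding submatrix is nonempty). Replace $y$ by $y+tw$, where $w\in\mathbb{R}^{2n-1}$ has $w_j=1$ for $j\in\bar C$, $w_{n+i}=-1$ for $i\in\bar R$, and all other entries $0$. This adds $t$ to every entry of $Y^{R,\bar C}$, subtracts $t$ from every entry of $Y^{\bar R,C}$, leaves the rest of $Y$ unchanged, and keeps $y$ in the same equivalence class. Repeat until $M$ is connected. The choices of $\mathcal B$ and of which of the two values of $t$ to use are not further prescribed. Modified semismooth Newton method: given $y^k$ with $F(y^k)\neq0$, (i) find a vertex $\tilde y^k$ of the polyhedron $[y^k]$ by applying the shifting procedure to $y^k$; (ii) let $\tilde V_k$ be the maximal matrix of the generalized Jacobian at $\tilde y^k$; (iii) set $y^{k+1}=\tilde y^k-\tilde V_k^{-1}F(\tilde y^k)$. The method stops if $F(y^k)=0$; stopping after finitely many steps at a point $y^k\in[y^*]$ counts as Q-quadratic convergence to $y^k$. Otherwise, $\{y^k\}$ converges Q-quadratically to $\bar y$ if $y^k\to\bar y$ and there is a constant $M_0>0$ with $\limsup_{k\to\infty}\|y^{k+1}-\bar y\|/\|y^k-\bar y\|^2<M_0$. *)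

theory Defs
  imports
    "Jordan_Normal_Form.Matrix"
    "HOL-Analysis.L2_Norm"
    "HOL-Library.Liminf_Limsup"
    "HOL-Library.Extended_Real"
begin

text \<open>
  All indices start at 0, so the last row of an \<open>n \<times> n\<close> matrix is row \<open>n - 1\<close>. The data of the
  problem are the size \<open>n\<close> and the matrix, called \<open>Xh\<close> below, that is to be projected.
\<close>

section \<open>Vectors and matrices\<close>

definition vec_norm2 :: "real vec \<Rightarrow> real" where
  "vec_norm2 v = L2_set (\<lambda>i. v $ i) {..<dim_vec v}"

definition dist_set :: "real vec \<Rightarrow> real vec set \<Rightarrow> real" where
  "dist_set y S = (INF s\<in>S. vec_norm2 (y - s))"

definition pos_vec :: "real vec \<Rightarrow> real vec" where
  "pos_vec v = map_vec (\<lambda>a. max a 0) v"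

definition pos_mat :: "real mat \<Rightarrow> real mat" where
  "pos_mat Y = map_mat (\<lambda>a. max a 0) Y"

text \<open>Column stacking and its inverse on vectors of length \<open>n\<^sup>2\<close>.\<close>

definition vec_stack :: "real mat \<Rightarrow> real vec" where
  "vec_stack X = vec (dim_row X * dim_col X) (\<lambda>k. X $$ (k mod dim_row X, k div dim_row X))"

definition unstack :: "nat \<Rightarrow> real vec \<Rightarrow> real mat" where
  "unstack n v = mat n n (\<lambda>(i, j). v $ (j * n + i))"

definition kron :: "real mat \<Rightarrow> real mat \<Rightarrow> real mat" where
  "kron P Q = mat (dim_row P * dim_row Q) (dim_col P * dim_col Q)
     (\<lambda>(i, j). P $$ (i div dim_row Q, j div dim_col Q) * Q $$ (i mod dim_row Q, j mod dim_col Q))"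

definition ones_row :: "nat \<Rightarrow> real mat" where
  "ones_row n = mat 1 n (\<lambda>_. 1)"


section \<open>The equation\<close>

text \<open>The first \<open>n\<close> rows of \<open>constr_mat n\<close> give the column sums, the remaining \<open>n - 1\<close> rows the row
  sums except the last one.\<close>

definition constr_mat :: "nat \<Rightarrow> real mat" where
  "constr_mat n = mat (2 * n - 1) (n * n)
     (\<lambda>rc. (kron (1\<^sub>m n) (ones_row n) @\<^sub>r kron (ones_row n) (1\<^sub>m n)) $$ rc)"

definition rhs_vec :: "nat \<Rightarrow> real vec" where
  "rhs_vec n = vec (2 * n - 1) (\<lambda>_. 1)"

definition affine_vec :: "nat \<Rightarrow> real mat \<Rightarrow> real vec \<Rightarrow> real vec" where
  "affine_vec n Xh y = vec_stack Xh + (constr_mat n)\<^sup>T *\<^sub>v y"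

definition residual :: "nat \<Rightarrow> real mat \<Rightarrow> real vec \<Rightarrow> real vec" where
  "residual n Xh y = constr_mat n *\<^sub>v pos_vec (affine_vec n Xh y) - rhs_vec n"

definition eq_class :: "nat \<Rightarrow> real mat \<Rightarrow> real vec \<Rightarrow> real vec set" where
  "eq_class n Xh y = {y' \<in> carrier_vec (2 * n - 1).
     pos_vec (affine_vec n Xh y') = pos_vec (affine_vec n Xh y)}"

definition Ymat :: "nat \<Rightarrow> real mat \<Rightarrow> real vec \<Rightarrow> real mat" where
  "Ymat n Xh y = unstack n (affine_vec n Xh y)"


section \<open>Bipartite graph, connectedness, blocks\<close>

datatype node = Row nat | Col nat

definition nodes :: "real mat \<Rightarrow> node set" where
  "nodes Z = Row ` {..<dim_row Z} \<union> Col ` {..<dim_col Z}"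

definition edges :: "real mat \<Rightarrow> (node \<times> node) set" where
  "edges Z = (\<Union>i<dim_row Z. \<Union>j<dim_col Z.
     if Z $$ (i, j) \<noteq> 0 then {(Row i, Col j), (Col j, Row i)} else {})"

definition same_component :: "real mat \<Rightarrow> (node \<times> node) set" where
  "same_component Z = (edges Z)\<^sup>* \<inter> nodes Z \<times> nodes Z"

definition connected_mat :: "real mat \<Rightarrow> bool" where
  "connected_mat Z \<longleftrightarrow> (\<forall>u\<in>nodes Z. \<forall>v\<in>nodes Z. (u, v) \<in> same_component Z)"

definition blocks :: "real mat \<Rightarrow> node set set" where
  "blocks Z = nodes Z // same_component Z"

definition block_rows :: "node set set \<Rightarrow> nat set" where
  "block_rows B = {i. Row i \<in> \<Union>B}"

definition block_cols :: "node set set \<Rightarrow> nat set" where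
  "block_cols B = {j. Col j \<in> \<Union>B}"


section \<open>Maximal matrix and shifting procedure\<close>

definition max_mask :: "nat \<Rightarrow> real mat \<Rightarrow> real vec \<Rightarrow> real mat" where
  "max_mask n Xh y = mat n n (\<lambda>ij. if Ymat n Xh y $$ ij \<ge> 0 then 1 else 0)"

definition max_jacobian :: "nat \<Rightarrow> real mat \<Rightarrow> real vec \<Rightarrow> real mat" where
  "max_jacobian n Xh y =
     constr_mat n * mat_diag (n * n) (\<lambda>k. vec_stack (max_mask n Xh y) $ k) * (constr_mat n)\<^sup>T"

text \<open>Instead of numbering the blocks so that the last one contains the last row, the block
  containing that row is required to belong to \<open>B\<close>.\<close>

definition admissible_blocks :: "nat \<Rightarrow> real mat \<Rightarrow> real vec \<Rightarrow> node set set \<Rightarrow> bool" where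
  "admissible_blocks n Xh y B \<longleftrightarrow>
     (let Y = Ymat n Xh y; R = block_rows B; C = block_cols B in
        B \<subset> blocks (pos_mat Y) \<and> (\<exists>b\<in>B. Row (n - 1) \<in> b) \<and>
        (\<forall>i\<in>R. \<forall>j\<in>{..<n} - C. Y $$ (i, j) < 0) \<and>
        (\<forall>i\<in>{..<n} - R. \<forall>j\<in>C. Y $$ (i, j) < 0))"

definition shift_direction :: "nat \<Rightarrow> nat set \<Rightarrow> nat set \<Rightarrow> real vec" where
  "shift_direction n Rbar Cbar = vec (2 * n - 1)
     (\<lambda>k. if k < n then (if k \<in> Cbar then 1 else 0) else (if k - n \<in> Rbar then - 1 else 0))"

definition shift_step :: "nat \<Rightarrow> real mat \<Rightarrow> real vec \<Rightarrow> real vec \<Rightarrow> bool" where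
  "shift_step n Xh y y' \<longleftrightarrow>
     \<not> connected_mat (max_mask n Xh y) \<and>
     (\<exists>B t. admissible_blocks n Xh y B \<and>
        (let Y = Ymat n Xh y; R = block_rows B; C = block_cols B;
             Rbar = {..<n} - R; Cbar = {..<n} - C in
           (R \<times> Cbar \<noteq> {} \<and> t = - Max ((\<lambda>ij. Y $$ ij) ` (R \<times> Cbar)) \<or>
            Rbar \<times> C \<noteq> {} \<and> t = Max ((\<lambda>ij. Y $$ ij) ` (Rbar \<times> C))) \<and>
           y' = y + t \<cdot>\<^sub>v shift_direction n Rbar Cbar))"

text \<open>\<open>z\<close> is a possible result of the (nondeterministic) procedure started at \<open>y\<close>.\<close>

definition shifting_result :: "nat \<Rightarrow> real mat \<Rightarrow> real vec \<Rightarrow> real vec \<Rightarrow> bool" where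
  "shifting_result n Xh y z \<longleftrightarrow>
     (shift_step n Xh)\<^sup>*\<^sup>* y z \<and> connected_mat (max_mask n Xh z)"

text \<open>Total correctness: started at \<open>y\<close>, the procedure never gets stuck and ends after finitely many
  steps, whatever choices are made.\<close>

inductive shifting_terminates :: "nat \<Rightarrow> real mat \<Rightarrow> real vec \<Rightarrow> bool" for n Xh where
  stop: "connected_mat (max_mask n Xh y) \<Longrightarrow> shifting_terminates n Xh y"
| step: "\<exists>y'. shift_step n Xh y y' \<Longrightarrow>
         (\<And>y'. shift_step n Xh y y' \<Longrightarrow> shifting_terminates n Xh y') \<Longrightarrow>
         shifting_terminates n Xh y"


section \<open>Modified semismooth Newton method\<close>

definition newton_step :: "nat \<Rightarrow> real mat \<Rightarrow> real vec \<Rightarrow> real vec \<Rightarrow> bool" where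
  "newton_step n Xh y y' \<longleftrightarrow>
     residual n Xh y \<noteq> 0\<^sub>v (2 * n - 1) \<and>
     (\<exists>z W. shifting_result n Xh y z \<and>
        inverts_mat (max_jacobian n Xh z) W \<and> inverts_mat W (max_jacobian n Xh z) \<and>
        y' = z - W *\<^sub>v residual n Xh z)"

text \<open>Once the method stops, the sequence is continued as a constant.\<close>

definition newton_sequence :: "nat \<Rightarrow> real mat \<Rightarrow> (nat \<Rightarrow> real vec) \<Rightarrow> bool" where
  "newton_sequence n Xh ys \<longleftrightarrow>
     (\<forall>k. if residual n Xh (ys k) = 0\<^sub>v (2 * n - 1) then ys (Suc k) = ys k
          else newton_step n Xh (ys k) (ys (Suc k)))"

text \<open>From no iterate reachable from \<open>y0\<close> can the method fail to produce the next one.\<close>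

definition newton_well_defined :: "nat \<Rightarrow> real mat \<Rightarrow> real vec \<Rightarrow> bool" where
  "newton_well_defined n Xh y0 \<longleftrightarrow>
     (\<forall>y. (newton_step n Xh)\<^sup>*\<^sup>* y0 y \<and> residual n Xh y \<noteq> 0\<^sub>v (2 * n - 1) \<longrightarrow>
        shifting_terminates n Xh y \<and>
        (\<forall>z. shifting_result n Xh y z \<longrightarrow> invertible_mat (max_jacobian n Xh z)))"

text \<open>Stopping after finitely many steps counts as quadratic convergence to the point reached.\<close>

definition q_quadratic :: "nat \<Rightarrow> real mat \<Rightarrow> (nat \<Rightarrow> real vec) \<Rightarrow> real vec \<Rightarrow> bool" where
  "q_quadratic n Xh ys ybar \<longleftrightarrow>
     (if \<exists>k. residual n Xh (ys k) = 0\<^sub>v (2 * n - 1)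
      then \<exists>k. residual n Xh (ys k) = 0\<^sub>v (2 * n - 1) \<and> ys k = ybar
      else (\<lambda>k. vec_norm2 (ys k - ybar)) \<longlonglongrightarrow> 0 \<and>
           (\<exists>M0>0. limsup (\<lambda>k. ereal (vec_norm2 (ys (Suc k) - ybar) / (vec_norm2 (ys k - ybar))\<^sup>2))
                    < ereal M0))"

end

theory Submission
  imports Defs "Jordan_Normal_Form.Determinant"
begin

text \<open>
  Near the solution set the method is not merely quadratically convergent: it stops after at most
  one step. The residual \<open>F\<close> is piecewise affine. On the closed cell of all \<open>y\<close> compatible with a
  given mask \<open>M\<close> it coincides with an affine map whose linear part is
  \<open>V = A Diag(vec M) A\<^sup>T\<close>. A vertex has a connected mask, and for a connected mask \<open>V\<close> is nonsingular
  (\<open>max_jacobian_nonsingular\<close>). Hence this affine map has exactly one zero, and a Newton step taken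
  from anywhere in the cell lands on it. If that zero is outside the cell, then the residual is
  bounded away from zero on the cell, the cell being closed. So once the residual is
  small, the zero lies in the cell and is a true zero of \<open>F\<close>
  (\<open>newton_step_exact_near_zero\<close>). There are finitely many masks, which makes the threshold uniform
  (\<open>newton_step_exact\<close>).

  However far the shifting procedure moves the iterate \<open>y\<close>, it stays in the class of \<open>y\<close>, where \<open>F\<close>
  is constant. Hence it is enough that \<open>F(y)\<close> is small, which holds near the solution set because
  \<open>F\<close> is Lipschitz continuous (\<open>pw_residual_lipschitz\<close>). Zeros of \<open>F\<close> belong to the class of \<open>y*\<close>
  by monotonicity of the positive part (\<open>pos_vec_eq_if_pw_residual_zero\<close>).

  For well-definedness, every shift makes at least one more entry nonnegative, so the procedure
  terminates, and the component of the last row in the graph of the mask provides an admissible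
  choice of blocks as long as the mask is disconnected (\<open>shift_step_exists\<close>).
\<close>

section \<open>Vectors and matrices\<close>

lemma real_mat_invertible_if_kernel_trivial:
  fixes V :: "real mat"
  assumes V: "V \<in> carrier_mat m m"
    and ker: "\<And>v. v \<in> carrier_vec m \<Longrightarrow> V *\<^sub>v v = 0\<^sub>v m \<Longrightarrow> v = 0\<^sub>v m"
  shows "\<exists>W\<in>carrier_mat m m. inverts_mat V W \<and> inverts_mat W V"
proof -
  have "det V \<noteq> 0"
    using ker det_0_iff_vec_prod_zero[OF V] by blast
  from det_non_zero_imp_unit[OF V this, unfolded Units_def, of "()"]
  obtain W where "W \<in> carrier_mat m m" "W * V = 1\<^sub>m m" "V * W = 1\<^sub>m m"
    by (auto simp: ring_mat_def)
  with V show ?thesis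
    unfolding inverts_mat_def by auto
qed

lemma inverts_mat_carrier:
  fixes V :: "real mat"
  assumes "V \<in> carrier_mat m m" "inverts_mat V W" "inverts_mat W V"
  shows "W \<in> carrier_mat m m"
proof -
  have "V * W = 1\<^sub>m m" "W * V = 1\<^sub>m (dim_row W)"
    using assms unfolding inverts_mat_def by auto
  then have "dim_col W = m" "dim_row W = m"
    using assms(1) by (metis index_mult_mat(3) index_one_mat(3), metis carrier_matD(2) index_mult_mat(3) index_one_mat(3))
  then show ?thesis by auto
qed

text \<open>Matrix-vector products are controlled entrywise. Bounds in the maximum norm suffice
  below, since \<open>vec_index_le_norm\<close> bounds that norm by the Euclidean one.\<close>

lemma mult_mat_vec_bound:
  fixes A :: "real mat"
  assumes A: "A \<in> carrier_mat m N"
  obtains K where "K > 0"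
    "\<And>v e k. v \<in> carrier_vec N \<Longrightarrow> e \<ge> 0 \<Longrightarrow> (\<And>l. l < N \<Longrightarrow> \<bar>v $ l\<bar> \<le> e) \<Longrightarrow> k < m \<Longrightarrow>
       \<bar>(A *\<^sub>v v) $ k\<bar> \<le> K * e"
proof
  let ?K = "1 + (\<Sum>k<m. \<Sum>l<N. \<bar>A $$ (k, l)\<bar>)"
  show "?K > 0"
    by (intro add_pos_nonneg sum_nonneg) auto
  fix v :: "real vec" and e :: real and k
  assume v: "v \<in> carrier_vec N" and e: "e \<ge> 0" and b: "\<And>l. l < N \<Longrightarrow> \<bar>v $ l\<bar> \<le> e" and k: "k < m"
  have "(A *\<^sub>v v) $ k = (\<Sum>l<N. A $$ (k, l) * v $ l)"
    using A v k by (auto simp: scalar_prod_def atLeast0LessThan)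
  also have "\<bar>\<dots>\<bar> \<le> (\<Sum>l<N. \<bar>A $$ (k, l)\<bar> * e)"
    by (rule order.trans[OF sum_abs], rule sum_mono) (simp add: abs_mult mult_left_mono b)
  also have "\<dots> = (\<Sum>l<N. \<bar>A $$ (k, l)\<bar>) * e"
    by (simp add: sum_distrib_right)
  also have "\<dots> \<le> ?K * e"
  proof (rule mult_right_mono[OF _ e])
    have "(\<Sum>l<N. \<bar>A $$ (k, l)\<bar>) \<le> (\<Sum>k<m. \<Sum>l<N. \<bar>A $$ (k, l)\<bar>)"
      by (rule member_le_sum[of k "{..<m}" "\<lambda>k. \<Sum>l<N. \<bar>A $$ (k, l)\<bar>"]) (use k in \<open>auto intro: sum_nonneg\<close>)
    then show "(\<Sum>l<N. \<bar>A $$ (k, l)\<bar>) \<le> ?K" by simp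
  qed
  finally show "\<bar>(A *\<^sub>v v) $ k\<bar> \<le> ?K * e" .
qed

lemma vec_index_le_norm: "k < dim_vec v \<Longrightarrow> \<bar>v $ k\<bar> \<le> vec_norm2 v"
  unfolding vec_norm2_def
  using member_le_L2_set[of "{..<dim_vec v}" k "\<lambda>i. \<bar>v $ i\<bar>"] by (simp add: L2_set_def)

lemma mat_diag_mult_vec:
  fixes v :: "real vec"
  assumes "v \<in> carrier_vec N"
  shows "mat_diag N d *\<^sub>v v = vec N (\<lambda>k. d k * v $ k)"
proof (rule eq_vecI)
  fix k assume "k < dim_vec (vec N (\<lambda>k. d k * v $ k))"
  then have k: "k < N" by simp
  have "(mat_diag N d *\<^sub>v v) $ k = (\<Sum>l\<in>{0..<N}. (if k = l then d l else 0) * v $ l)"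
    using assms k by (auto simp: mat_diag_def scalar_prod_def intro!: sum.cong)
  also have "\<dots> = (\<Sum>l\<in>{0..<N}. if k = l then d l * v $ l else 0)"
    by (rule sum.cong) auto
  also have "\<dots> = d k * v $ k"
    using k by simp
  finally show "(mat_diag N d *\<^sub>v v) $ k = vec N (\<lambda>k. d k * v $ k) $ k"
    using k by simp
qed (simp add: mat_diag_def)

section \<open>Equations with a positive part\<close>

definition pw_residual :: "real mat \<Rightarrow> real vec \<Rightarrow> real vec \<Rightarrow> real vec \<Rightarrow> real vec" where
  "pw_residual A x b y = A *\<^sub>v pos_vec (x + A\<^sup>T *\<^sub>v y) - b"

text \<open>The 0/1 diagonals \<open>d\<close> for which the positive part of \<open>u\<close> is the linear image \<open>Diag(d) u\<close>. On a zero
  entry either value is allowed, so that for fixed \<open>d\<close> the vectors satisfying the condition form a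
  \<^emph>\<open>closed\<close> orthant; this closedness is what \<open>sign_mask_stable\<close> exploits.\<close>

definition sign_mask :: "(nat \<Rightarrow> real) \<Rightarrow> real vec \<Rightarrow> bool" where
  "sign_mask d u \<longleftrightarrow> (\<forall>k<dim_vec u. d k = 1 \<and> 0 \<le> u $ k \<or> d k = 0 \<and> u $ k \<le> 0)"

lemma pos_vec_dim [simp]: "dim_vec (pos_vec u) = dim_vec u"
  by (simp add: pos_vec_def)

lemma pos_vec_carrier [simp]: "u \<in> carrier_vec N \<Longrightarrow> pos_vec u \<in> carrier_vec N"
  by (simp add: pos_vec_def)

lemma pos_vec_index [simp]: "k < dim_vec u \<Longrightarrow> pos_vec u $ k = max (u $ k) 0"
  by (simp add: pos_vec_def)

lemma pw_residual_carrier: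
  "A \<in> carrier_mat m N \<Longrightarrow> b \<in> carrier_vec m \<Longrightarrow> pw_residual A x b y \<in> carrier_vec m"
  unfolding pw_residual_def by (intro carrier_vecI) simp

lemma pos_vec_sign_mask:
  assumes "sign_mask d u" "u \<in> carrier_vec N"
  shows "pos_vec u = mat_diag N d *\<^sub>v u"
  using assms by (intro eq_vecI) (auto simp: mat_diag_mult_vec sign_mask_def)

text \<open>With \<open>u = x + A\<^sup>T y\<close> and \<open>p = u\<^sub>+ - u'\<^sub>+\<close>, two solutions satisfy \<open>A p = 0\<close>, hence
  \<open>\<langle>u - u', p\<rangle> = \<langle>y - y', A p\<rangle> = 0\<close>. The positive part is firmly nonexpansive, so this inner product is
  at least \<open>\<parallel>p\<parallel>\<^sup>2\<close>, and \<open>p = 0\<close>. Therefore all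
  zeros of the residual lie in one equivalence class.\<close>

lemma pos_vec_eq_if_pw_residual_zero:
  assumes A: "A \<in> carrier_mat m N" and x: "x \<in> carrier_vec N" and b: "b \<in> carrier_vec m"
    and y: "y \<in> carrier_vec m" and y': "y' \<in> carrier_vec m"
    and "pw_residual A x b y = 0\<^sub>v m" "pw_residual A x b y' = 0\<^sub>v m"
  shows "pos_vec (x + A\<^sup>T *\<^sub>v y) = pos_vec (x + A\<^sup>T *\<^sub>v y')"
proof -
  define u u' where "u = x + A\<^sup>T *\<^sub>v y" and "u' = x + A\<^sup>T *\<^sub>v y'"
  have u: "u \<in> carrier_vec N" "u' \<in> carrier_vec N"
    using A x y y' by (auto simp: u_def u'_def)
  define p where "p = pos_vec u - pos_vec u'"
  have p: "p \<in> carrier_vec N" using u by (auto simp: p_def)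
  have solved: "A *\<^sub>v pos_vec w = b" if "A *\<^sub>v pos_vec w - b = 0\<^sub>v m" for w
  proof (rule eq_vecI)
    fix k assume "k < dim_vec b"
    then have k: "k < m" using b by auto
    have "(A *\<^sub>v pos_vec w - b) $ k = 0" using that k by simp
    then show "(A *\<^sub>v pos_vec w) $ k = b $ k" using k b A by simp
  qed (use A b in auto)
  have Ap: "A *\<^sub>v p = 0\<^sub>v m"
    using assms(6,7) solved[of u] solved[of u'] A u b
    by (simp add: p_def pw_residual_def u_def u'_def mult_minus_distrib_mat_vec[OF A])
  have diff: "u - u' = A\<^sup>T *\<^sub>v (y - y')"
  proof -
    have "A\<^sup>T *\<^sub>v (y - y') = A\<^sup>T *\<^sub>v y - A\<^sup>T *\<^sub>v y'"
      using A y y' by (intro mult_minus_distrib_mat_vec) auto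
    then show ?thesis using A x y y' by (intro eq_vecI) (auto simp: u_def u'_def)
  qed
  have "(\<Sum>k<N. (u $ k - u' $ k) * p $ k) = (u - u') \<bullet> p"
    using u p by (auto simp: scalar_prod_def atLeast0LessThan)
  also have "\<dots> = (y - y') \<bullet> (A *\<^sub>v p)"
    unfolding diff by (rule transpose_vec_mult_scalar[OF A p]) (use y y' in auto)
  also have "\<dots> = 0"
    unfolding Ap using y y' by simp
  finally have zero: "(\<Sum>k<N. (u $ k - u' $ k) * p $ k) = 0" .
  have le: "(p $ k)\<^sup>2 \<le> (u $ k - u' $ k) * p $ k" if "k < N" for k
  proof -
    have pk: "p $ k = max (u $ k) 0 - max (u' $ k) 0"
      using that u by (simp add: p_def)
    have "0 \<le> (a - a' - (max a 0 - max a' 0)) * (max a 0 - max a' 0)" for a a' :: real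
      by (auto simp: max_def mult_nonneg_nonpos mult_nonneg_nonpos2)
    from this[of "u $ k" "u' $ k"] show ?thesis
      unfolding pk by (simp add: power2_eq_square algebra_simps)
  qed
  have "(\<Sum>k<N. (p $ k)\<^sup>2) \<le> 0"
    unfolding zero[symmetric] by (rule sum_mono) (use le in auto)
  then have "(\<Sum>k<N. (p $ k)\<^sup>2) = 0"
    by (intro antisym sum_nonneg) auto
  then have "\<forall>k\<in>{..<N}. (p $ k)\<^sup>2 = 0"
    by (subst (asm) sum_nonneg_eq_0_iff) auto
  then have "pos_vec u $ k = pos_vec u' $ k" if "k < N" for k
    using that u by (auto simp: p_def)
  then show ?thesis
    using u unfolding u_def[symmetric] u'_def[symmetric] by (intro eq_vecI) auto
qed

text \<open>The map \<open>y \<mapsto> A Diag(d) (x + A\<^sup>T y) - b\<close> is affine with derivative \<open>V\<close> and agrees with the residual at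
  \<open>z\<close>. A Newton step from \<open>z\<close> thus reaches a zero of this affine piece, whether or not the residual
  still agrees with the piece there.\<close>

lemma newton_candidate:
  assumes A: "A \<in> carrier_mat m N" and x: "x \<in> carrier_vec N" and b: "b \<in> carrier_vec m"
    and V: "V = A * mat_diag N d * A\<^sup>T" and W: "W \<in> carrier_mat m m"
    and VW: "V * W = 1\<^sub>m m"
    and z: "z \<in> carrier_vec m" and mask: "sign_mask d (x + A\<^sup>T *\<^sub>v z)"
  shows "A *\<^sub>v (mat_diag N d *\<^sub>v (x + A\<^sup>T *\<^sub>v (z - W *\<^sub>v pw_residual A x b z))) = b"
proof -
  define r where "r = pw_residual A x b z"
  have r: "r \<in> carrier_vec m" using A b unfolding r_def by (rule pw_residual_carrier)
  define Dg where "Dg = mat_diag N d"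
  have D: "Dg \<in> carrier_mat N N" by (simp add: Dg_def)
  define u where "u = x + A\<^sup>T *\<^sub>v z"
  have u: "u \<in> carrier_vec N" using A x z by (auto simp: u_def)
  have AT: "A\<^sup>T \<in> carrier_mat N m" using A by auto
  have Wr: "W *\<^sub>v r \<in> carrier_vec m" using W r by auto
  define q where "q = A\<^sup>T *\<^sub>v (W *\<^sub>v r)"
  have q: "q \<in> carrier_vec N" using AT Wr by (auto simp: q_def)
  have split: "x + A\<^sup>T *\<^sub>v (z - W *\<^sub>v r) = u - q"
    unfolding u_def q_def mult_minus_distrib_mat_vec[OF AT z Wr]
    using x AT z Wr by (intro eq_vecI) auto
  have "A *\<^sub>v (Dg *\<^sub>v q) = V *\<^sub>v (W *\<^sub>v r)"
    unfolding q_def V Dg_def[symmetric]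
    using assoc_mult_mat_vec[OF mult_carrier_mat[OF A D] AT Wr]
      assoc_mult_mat_vec[OF A D, of "A\<^sup>T *\<^sub>v (W *\<^sub>v r)"] AT Wr by auto
  also have "\<dots> = (V * W) *\<^sub>v r"
    using V A W r D by (intro assoc_mult_mat_vec[symmetric, where n\<^sub>1=m and n\<^sub>2=m]) auto
  also have "\<dots> = r" using VW r by simp
  finally have Vq: "A *\<^sub>v (Dg *\<^sub>v q) = r" .
  have ru: "r = A *\<^sub>v (Dg *\<^sub>v u) - b"
    unfolding r_def pw_residual_def u_def[symmetric] Dg_def
    by (subst pos_vec_sign_mask[OF _ u]) (use mask u_def in auto)
  have "A *\<^sub>v (Dg *\<^sub>v (u - q)) = A *\<^sub>v (Dg *\<^sub>v u) - A *\<^sub>v (Dg *\<^sub>v q)"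
    using mult_minus_distrib_mat_vec[OF D u q] mult_minus_distrib_mat_vec[OF A, of "Dg *\<^sub>v u" "Dg *\<^sub>v q"] D u q by auto
  also have "\<dots> = b"
    unfolding Vq ru using A b by (intro eq_vecI) auto
  finally show ?thesis
    using split unfolding r_def Dg_def by simp
qed

text \<open>A vector outside the closed orthant given by \<open>d\<close> violates one of its finitely many sign conditions by
  a definite margin, so it has a positive distance from the orthant.\<close>

lemma sign_mask_stable:
  obtains \<epsilon> where "\<epsilon> > 0"
    "\<And>u'. dim_vec u' = dim_vec u \<Longrightarrow> sign_mask d u' \<Longrightarrow>
       (\<And>k. k < dim_vec u \<Longrightarrow> \<bar>u $ k - u' $ k\<bar> < \<epsilon>) \<Longrightarrow> sign_mask d u"
proof -
  let ?P = "\<lambda>k e. u $ k = 0 \<or> e \<le> \<bar>u $ k\<bar>"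
  \<comment> \<open>An entry of \<open>u\<close> that is at least \<open>e\<close> in modulus keeps its sign under a perturbation smaller than \<open>e\<close>,
    and a zero entry satisfies the condition for either value of \<open>d k\<close>.\<close>
  have "eventually (\<lambda>e. \<forall>k\<in>{..<dim_vec u}. ?P k e) (at_right (0::real))"
  proof (rule eventually_ball_finite, simp, intro ballI)
    fix k
    show "eventually (?P k) (at_right (0::real))"
    proof (cases "u $ k = 0")
      case False
      then have "eventually (\<lambda>e. e < \<bar>u $ k\<bar>) (at_right (0::real))"
        by (intro order_tendstoD(2)[of "\<lambda>e. e"]) auto
      then show ?thesis by eventually_elim auto
    qed simp
  qed
  moreover have "eventually (\<lambda>e. e > 0) (at_right (0::real))"
    by (simp add: eventually_at_right_less)
  ultimately have "eventually (\<lambda>e. e > 0 \<and> (\<forall>k<dim_vec u. ?P k e)) (at_right (0::real))"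
    by eventually_elim auto
  then obtain e where e: "e > 0" and P: "\<And>k. k < dim_vec u \<Longrightarrow> ?P k e"
    using eventually_happens trivial_limit_at_right_real by blast
  show thesis
  proof (rule that[OF e])
    fix u' assume dim: "dim_vec u' = dim_vec u" and m: "sign_mask d u'"
      and near: "\<And>k. k < dim_vec u \<Longrightarrow> \<bar>u $ k - u' $ k\<bar> < e"
    show "sign_mask d u"
      unfolding sign_mask_def
    proof (intro allI impI)
      fix k assume k: "k < dim_vec u"
      have "d k = 1 \<and> 0 \<le> u' $ k \<or> d k = 0 \<and> u' $ k \<le> 0"
        using m k dim by (simp add: sign_mask_def)
      with P[OF k] near[OF k] show "d k = 1 \<and> 0 \<le> u $ k \<or> d k = 0 \<and> u $ k \<le> 0"
        by auto
    qed
  qed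
qed

text \<open>The affine piece belonging to \<open>d\<close> has exactly one zero \<open>s\<close> when \<open>V\<close> is invertible, so the Newton step
  ends at the same \<open>s\<close> from every starting point \<open>z\<close> of the cell. The length of the step is bounded by a
  constant times the residual at \<open>z\<close>. If \<open>s\<close> lies outside the closed cell, the residual on the cell
  is therefore bounded away from zero; a small residual forces \<open>s\<close> into the cell, where the
  piece and the residual agree.\<close>

lemma newton_step_exact_near_zero:
  assumes A: "A \<in> carrier_mat m N" and x: "x \<in> carrier_vec N" and b: "b \<in> carrier_vec m"
    and V: "V = A * mat_diag N d * A\<^sup>T"
  obtains \<epsilon> where "\<epsilon> > 0"
    "\<And>z W. z \<in> carrier_vec m \<Longrightarrow> sign_mask d (x + A\<^sup>T *\<^sub>v z) \<Longrightarrow>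
       inverts_mat V W \<Longrightarrow> inverts_mat W V \<Longrightarrow>
       (\<And>k. k < m \<Longrightarrow> \<bar>pw_residual A x b z $ k\<bar> < \<epsilon>) \<Longrightarrow>
       pw_residual A x b (z - W *\<^sub>v pw_residual A x b z) = 0\<^sub>v m"
proof (cases "\<exists>W. inverts_mat V W \<and> inverts_mat W V")
  case False
  then show thesis by (intro that[of 1]) auto
next
  case True
  have Vc: "V \<in> carrier_mat m m" using A V by (auto simp: mat_diag_def)
  have D: "mat_diag N d \<in> carrier_mat N N" by simp
  have AT: "A\<^sup>T \<in> carrier_mat N m" using A by auto
  obtain W0 where W0: "inverts_mat V W0" "inverts_mat W0 V" using True by blast
  have W0c: "W0 \<in> carrier_mat m m" using inverts_mat_carrier[OF Vc W0] .
  have VW0: "V * W0 = 1\<^sub>m m" "W0 * V = 1\<^sub>m m" using W0 Vc W0c by (auto simp: inverts_mat_def)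
  define s where "s = W0 *\<^sub>v (b - A *\<^sub>v (mat_diag N d *\<^sub>v x))"
  have s: "s \<in> carrier_vec m" using W0c A b unfolding s_def by (intro carrier_vecI) simp
  define us where "us = x + A\<^sup>T *\<^sub>v s"
  have us: "us \<in> carrier_vec N" using x AT s by (auto simp: us_def)
  obtain K1 where K1: "K1 > 0"
    "\<And>v e k. v \<in> carrier_vec m \<Longrightarrow> e \<ge> 0 \<Longrightarrow> (\<And>l. l < m \<Longrightarrow> \<bar>v $ l\<bar> \<le> e) \<Longrightarrow> k < m \<Longrightarrow>
       \<bar>(W0 *\<^sub>v v) $ k\<bar> \<le> K1 * e"
    using mult_mat_vec_bound[OF W0c] by blast
  obtain K2 where K2: "K2 > 0"
    "\<And>v e k. v \<in> carrier_vec m \<Longrightarrow> e \<ge> 0 \<Longrightarrow> (\<And>l. l < m \<Longrightarrow> \<bar>v $ l\<bar> \<le> e) \<Longrightarrow> k < N \<Longrightarrow>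
       \<bar>(A\<^sup>T *\<^sub>v v) $ k\<bar> \<le> K2 * e"
    using mult_mat_vec_bound[OF AT] by blast
  obtain e where e: "e > 0"
    and stable: "\<And>u'. dim_vec u' = dim_vec us \<Longrightarrow> sign_mask d u' \<Longrightarrow>
       (\<And>k. k < dim_vec us \<Longrightarrow> \<bar>us $ k - u' $ k\<bar> < e) \<Longrightarrow> sign_mask d us"
    using sign_mask_stable[of us d] by blast
  \<comment> \<open>A residual below \<open>\<epsilon>\<close> moves every entry of \<open>x + A\<^sup>T z\<close> by less than \<open>e\<close> in one Newton step.\<close>
  define \<epsilon> where "\<epsilon> = e / (2 * K1 * K2)"
  have \<epsilon>: "\<epsilon> > 0" using e K1(1) K2(1) by (simp add: \<epsilon>_def)
  have small: "K2 * (K1 * \<epsilon>) < e" using e K1(1) K2(1) by (simp add: \<epsilon>_def field_simps)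
  show thesis
  proof (rule that[OF \<epsilon>])
    fix z W
    assume z: "z \<in> carrier_vec m" and mask: "sign_mask d (x + A\<^sup>T *\<^sub>v z)"
      and W: "inverts_mat V W" "inverts_mat W V"
      and bd: "\<And>k. k < m \<Longrightarrow> \<bar>pw_residual A x b z $ k\<bar> < \<epsilon>"
    define r where "r = pw_residual A x b z"
    have r: "r \<in> carrier_vec m" using A b unfolding r_def by (rule pw_residual_carrier)
    have Wc: "W \<in> carrier_mat m m" using inverts_mat_carrier[OF Vc W] .
    have VW: "V * W = 1\<^sub>m m" using W Vc by (auto simp: inverts_mat_def)
    have "W = W0 * V * W" using VW0 Wc by simp
    also have "\<dots> = W0"
      using VW assoc_mult_mat[OF W0c Vc Wc] W0c by simp
    finally have WW0: "W = W0" .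
    define y where "y = z - W *\<^sub>v r"
    have Wr: "W *\<^sub>v r \<in> carrier_vec m" using Wc r by auto
    have y: "y \<in> carrier_vec m" using z Wr by (auto simp: y_def)
    have cand: "A *\<^sub>v (mat_diag N d *\<^sub>v (x + A\<^sup>T *\<^sub>v y)) = b"
      unfolding y_def r_def by (rule newton_candidate[OF A x b V Wc VW z mask])
    have ATy: "A\<^sup>T *\<^sub>v y \<in> carrier_vec N" using AT y by auto
    have "A *\<^sub>v (mat_diag N d *\<^sub>v (x + A\<^sup>T *\<^sub>v y)) = A *\<^sub>v (mat_diag N d *\<^sub>v x) + V *\<^sub>v y"
      using mult_add_distrib_mat_vec[OF D x ATy]
        mult_add_distrib_mat_vec[OF A, of "mat_diag N d *\<^sub>v x" "mat_diag N d *\<^sub>v (A\<^sup>T *\<^sub>v y)"]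
        assoc_mult_mat_vec[OF mult_carrier_mat[OF A D] AT y]
        assoc_mult_mat_vec[OF A D ATy] D x ATy V by auto
    with cand have "V *\<^sub>v y = b - A *\<^sub>v (mat_diag N d *\<^sub>v x)"
      using A Vc y by (intro eq_vecI) auto
    then have ys: "y = s"
      unfolding s_def using assoc_mult_mat_vec[OF W0c Vc y] VW0 y by simp
    have "\<bar>us $ k - (x + A\<^sup>T *\<^sub>v z) $ k\<bar> < e" if k: "k < N" for k
    proof -
      have "us - (x + A\<^sup>T *\<^sub>v z) = - (A\<^sup>T *\<^sub>v (W *\<^sub>v r))"
        unfolding us_def ys[symmetric] y_def mult_minus_distrib_mat_vec[OF AT z Wr]
        using x AT z Wr by (intro eq_vecI) auto
      then have "(us - (x + A\<^sup>T *\<^sub>v z)) $ k = - (A\<^sup>T *\<^sub>v (W *\<^sub>v r)) $ k"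
        using k AT by auto
      then have "us $ k - (x + A\<^sup>T *\<^sub>v z) $ k = - (A\<^sup>T *\<^sub>v (W *\<^sub>v r)) $ k"
        using k us x AT z by simp
      moreover have "\<bar>(A\<^sup>T *\<^sub>v (W *\<^sub>v r)) $ k\<bar> \<le> K2 * (K1 * \<epsilon>)"
      proof (rule K2(2)[OF Wr _ _ k])
        show "0 \<le> K1 * \<epsilon>" using K1(1) \<epsilon> by simp
        show "\<bar>(W *\<^sub>v r) $ l\<bar> \<le> K1 * \<epsilon>" if "l < m" for l
          unfolding WW0 by (rule K1(2)[OF r _ _ that]) (use \<epsilon> bd r_def in \<open>auto intro: less_imp_le\<close>)
      qed
      ultimately show ?thesis using small by linarith
    qed
    then have "sign_mask d us"
      using mask us x AT z by (intro stable[of "x + A\<^sup>T *\<^sub>v z"]) auto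
    then have "pos_vec us = mat_diag N d *\<^sub>v us" using pos_vec_sign_mask us by blast
    then have "pw_residual A x b y = b - b"
      using cand unfolding pw_residual_def ys us_def[symmetric] by simp
    then show "pw_residual A x b (z - W *\<^sub>v pw_residual A x b z) = 0\<^sub>v m"
      unfolding y_def r_def using b by simp
  qed
qed

lemma pw_residual_lipschitz:
  assumes A: "A \<in> carrier_mat m N" and x: "x \<in> carrier_vec N" and b: "b \<in> carrier_vec m"
  obtains K where "K > 0"
    "\<And>y s e k. y \<in> carrier_vec m \<Longrightarrow> s \<in> carrier_vec m \<Longrightarrow> vec_norm2 (y - s) \<le> e \<Longrightarrow> k < m \<Longrightarrow>
       \<bar>pw_residual A x b y $ k - pw_residual A x b s $ k\<bar> \<le> K * e"
proof -
  have AT: "A\<^sup>T \<in> carrier_mat N m" using A by auto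
  obtain K1 where K1: "K1 > 0"
    "\<And>v e k. v \<in> carrier_vec N \<Longrightarrow> e \<ge> 0 \<Longrightarrow> (\<And>l. l < N \<Longrightarrow> \<bar>v $ l\<bar> \<le> e) \<Longrightarrow> k < m \<Longrightarrow>
       \<bar>(A *\<^sub>v v) $ k\<bar> \<le> K1 * e"
    using mult_mat_vec_bound[OF A] by blast
  obtain K2 where K2: "K2 > 0"
    "\<And>v e k. v \<in> carrier_vec m \<Longrightarrow> e \<ge> 0 \<Longrightarrow> (\<And>l. l < m \<Longrightarrow> \<bar>v $ l\<bar> \<le> e) \<Longrightarrow> k < N \<Longrightarrow>
       \<bar>(A\<^sup>T *\<^sub>v v) $ k\<bar> \<le> K2 * e"
    using mult_mat_vec_bound[OF AT] by blast
  show thesis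
  proof (rule that[of "K1 * K2"])
    show "K1 * K2 > 0" using K1(1) K2(1) by simp
    fix y s e k
    assume y: "y \<in> carrier_vec m" and s: "s \<in> carrier_vec m" and d: "vec_norm2 (y - s) \<le> e" and k: "k < m"
    have e: "e \<ge> 0" using d by (simp add: vec_norm2_def order.trans[OF L2_set_nonneg])
    define u v where "u = x + A\<^sup>T *\<^sub>v y" and "v = x + A\<^sup>T *\<^sub>v s"
    have uv: "u \<in> carrier_vec N" "v \<in> carrier_vec N" using x AT y s by (auto simp: u_def v_def)
    have "\<bar>(A *\<^sub>v (pos_vec u - pos_vec v)) $ k\<bar> \<le> K1 * (K2 * e)"
    proof (rule K1(2)[OF _ _ _ k])
      show "0 \<le> K2 * e" using K2(1) e by simp
      fix l assume l: "l < N"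
      have "u - v = A\<^sup>T *\<^sub>v (y - s)"
        unfolding mult_minus_distrib_mat_vec[OF AT y s] using x AT y s
        by (intro eq_vecI) (auto simp: u_def v_def)
      then have "(u - v) $ l = (A\<^sup>T *\<^sub>v (y - s)) $ l" by simp
      then have "u $ l - v $ l = (A\<^sup>T *\<^sub>v (y - s)) $ l" using uv l by simp
      moreover have "\<bar>(A\<^sup>T *\<^sub>v (y - s)) $ l\<bar> \<le> K2 * e"
        by (rule K2(2)[OF _ e _ l]) (use y s d vec_index_le_norm[of _ "y - s"] in \<open>auto intro: order.trans\<close>)
      ultimately show "\<bar>(pos_vec u - pos_vec v) $ l\<bar> \<le> K2 * e"
        using uv l by (auto simp: max_def)
    qed (use uv in auto)
    moreover have "pw_residual A x b y $ k - pw_residual A x b s $ k = (A *\<^sub>v (pos_vec u - pos_vec v)) $ k"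
      unfolding pw_residual_def u_def[symmetric] v_def[symmetric]
        mult_minus_distrib_mat_vec[OF A pos_vec_carrier[OF uv(1)] pos_vec_carrier[OF uv(2)]]
      using k A b uv by simp
    ultimately show "\<bar>pw_residual A x b y $ k - pw_residual A x b s $ k\<bar> \<le> K1 * K2 * e"
      by simp
  qed
qed

section \<open>Row and column multipliers\<close>

text \<open>The multiplier of row \<open>i\<close>. Dropping the last equation amounts to fixing the multiplier of
  row \<open>n - 1\<close> at zero.\<close>

definition row_mult :: "nat \<Rightarrow> real vec \<Rightarrow> nat \<Rightarrow> real" where
  "row_mult n y i = (if i < n - 1 then y $ (n + i) else 0)"

lemma constr_mat_carrier: "constr_mat n \<in> carrier_mat (2 * n - 1) (n * n)"
  by (simp add: constr_mat_def)

lemma constr_mat_index: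
  assumes "r < 2 * n - 1" "k < n * n"
  shows "constr_mat n $$ (r, k) =
    (if r < n then of_bool (r = k div n) else of_bool (r - n = k mod n))"
proof -
  have n: "n > 0" using assms by (cases n) auto
  have kd: "k div n < n" "k mod n < n" using assms n by (auto simp: less_mult_imp_div_less)
  show ?thesis
    using assms n kd
    by (auto simp: constr_mat_def append_rows_def kron_def ones_row_def)
qed

lemma constr_mat_transpose_mult:
  assumes n: "n \<ge> 1" and y: "y \<in> carrier_vec (2 * n - 1)" and k: "k < n * n"
  shows "((constr_mat n)\<^sup>T *\<^sub>v y) $ k = y $ (k div n) + row_mult n y (k mod n)"
proof -
  have kd: "k div n < n" "k mod n < n" using k n by (auto simp: less_mult_imp_div_less)
  have "((constr_mat n)\<^sup>T *\<^sub>v y) $ k = (\<Sum>r\<in>{0..<2 * n - 1}. constr_mat n $$ (r, k) * y $ r)"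
    using y k constr_mat_carrier[of n] by (auto simp: scalar_prod_def intro!: sum.cong)
  also have "\<dots> = (\<Sum>r\<in>{0..<n} \<union> {n..<2 * n - 1}. constr_mat n $$ (r, k) * y $ r)"
    by (rule sum.cong) (use n in auto)
  also have "\<dots> = (\<Sum>r\<in>{0..<n}. constr_mat n $$ (r, k) * y $ r) +
      (\<Sum>r\<in>{n..<2 * n - 1}. constr_mat n $$ (r, k) * y $ r)"
    by (rule sum.union_disjoint) auto
  also have "(\<Sum>r\<in>{0..<n}. constr_mat n $$ (r, k) * y $ r) =
      (\<Sum>r\<in>{0..<n}. if r = k div n then y $ r else 0)"
    by (rule sum.cong) (use n k in \<open>auto simp: constr_mat_index\<close>)
  also have "\<dots> = y $ (k div n)" using kd by simp
  also have "(\<Sum>r\<in>{n..<2 * n - 1}. constr_mat n $$ (r, k) * y $ r) =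
      (\<Sum>r\<in>{n..<2 * n - 1}. if r = n + k mod n then y $ r else 0)"
    by (rule sum.cong) (use n k in \<open>auto simp: constr_mat_index\<close>)
  also have "\<dots> = row_mult n y (k mod n)"
    using kd by (auto simp: row_mult_def)
  finally show ?thesis .
qed

lemma affine_vec_carrier:
  assumes "Xh \<in> carrier_mat n n"
  shows "affine_vec n Xh y \<in> carrier_vec (n * n)"
  using assms constr_mat_carrier[of n] by (intro carrier_vecI) (simp add: affine_vec_def)

lemma affine_vec_index:
  assumes "n \<ge> 1" "Xh \<in> carrier_mat n n" "y \<in> carrier_vec (2 * n - 1)" "k < n * n"
  shows "affine_vec n Xh y $ k = Ymat n Xh y $$ (k mod n, k div n)"
proof -
  have "k div n < n" "k mod n < n" using assms by (auto simp: less_mult_imp_div_less)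
  then show ?thesis by (simp add: Ymat_def unstack_def)
qed

lemma index_pair_less: "i < n \<Longrightarrow> j < n \<Longrightarrow> j * n + i < n * (n::nat)"
proof -
  assume "i < n" "j < n"
  then have "j * n + i < Suc j * n" by simp
  also have "\<dots> \<le> n * n" using \<open>j < n\<close> by (intro mult_right_mono) auto
  finally show ?thesis .
qed

lemma Ymat_index:
  assumes n: "n \<ge> 1" and X: "Xh \<in> carrier_mat n n" and y: "y \<in> carrier_vec (2 * n - 1)"
    and i: "i < n" and j: "j < n"
  shows "Ymat n Xh y $$ (i, j) = Xh $$ (i, j) + y $ j + row_mult n y i"
proof -
  have k: "j * n + i < n * n" using i j by (rule index_pair_less)
  have "Ymat n Xh y $$ (i, j) = vec_stack Xh $ (j * n + i) + ((constr_mat n)\<^sup>T *\<^sub>v y) $ (j * n + i)"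
    using i j k constr_mat_carrier[of n] by (simp add: Ymat_def unstack_def affine_vec_def)
  then show ?thesis
    using constr_mat_transpose_mult[OF n y k] X i j k by (simp add: vec_stack_def)
qed

lemma Ymat_dims [simp]: "dim_row (Ymat n Xh y) = n" "dim_col (Ymat n Xh y) = n"
  by (simp_all add: Ymat_def unstack_def)

lemma max_mask_dims [simp]: "dim_row (max_mask n Xh y) = n" "dim_col (max_mask n Xh y) = n"
  by (simp_all add: max_mask_def)

lemma max_mask_index:
  "i < n \<Longrightarrow> j < n \<Longrightarrow> max_mask n Xh y $$ (i, j) = (if Ymat n Xh y $$ (i, j) \<ge> 0 then 1 else 0)"
  by (simp add: max_mask_def)

lemma pos_vec_affine_eqI:
  assumes n: "n \<ge> 1" and X: "Xh \<in> carrier_mat n n"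
    and y: "y \<in> carrier_vec (2 * n - 1)" and y': "y' \<in> carrier_vec (2 * n - 1)"
    and "\<And>i j. i < n \<Longrightarrow> j < n \<Longrightarrow> max (Ymat n Xh y $$ (i, j)) 0 = max (Ymat n Xh y' $$ (i, j)) 0"
  shows "pos_vec (affine_vec n Xh y) = pos_vec (affine_vec n Xh y')"
proof (rule eq_vecI)
  fix k assume "k < dim_vec (pos_vec (affine_vec n Xh y'))"
  then have k: "k < n * n" using affine_vec_carrier[OF X, of y'] by simp
  then have "k div n < n" "k mod n < n" using n by (auto simp: less_mult_imp_div_less)
  then show "pos_vec (affine_vec n Xh y) $ k = pos_vec (affine_vec n Xh y') $ k"
    using k affine_vec_carrier[OF X, of y'] affine_vec_carrier[OF X, of y] assms(5)
    by (simp add: affine_vec_index[OF n X y] affine_vec_index[OF n X y'])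
qed (use affine_vec_carrier[OF X, of y'] affine_vec_carrier[OF X, of y] in simp)

section \<open>Components of the bipartite graph\<close>

lemma edges_iff:
  "(u, v) \<in> edges Z \<longleftrightarrow> (\<exists>i<dim_row Z. \<exists>j<dim_col Z. Z $$ (i, j) \<noteq> 0 \<and>
     (u = Row i \<and> v = Col j \<or> u = Col j \<and> v = Row i))"
  unfolding edges_def by (auto split: if_splits)

lemma edges_sym: "sym (edges Z)"
  unfolding sym_def edges_iff by blast

lemma same_component_equiv: "equiv (nodes Z) (same_component Z)"
proof (rule equivI)
  show "same_component Z \<subseteq> nodes Z \<times> nodes Z" by (auto simp: same_component_def)
  show "refl_on (nodes Z) (same_component Z)"
    by (auto simp: refl_on_def same_component_def)
  show "sym (same_component Z)"
    using sym_rtrancl[OF edges_sym[of Z]] by (auto simp: sym_def same_component_def)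
  show "trans (same_component Z)"
    using trans_rtrancl by (auto simp: trans_def same_component_def intro: rtrancl_trans)
qed

lemma same_component_mono:
  assumes "edges Z \<subseteq> edges Z'" "nodes Z = nodes Z'"
  shows "same_component Z \<subseteq> same_component Z'"
  using rtrancl_mono[OF assms(1)] assms(2) by (auto simp: same_component_def)

lemma connected_mat_potential:
  assumes conn: "connected_mat Z"
    and edge: "\<And>i j. i < dim_row Z \<Longrightarrow> j < dim_col Z \<Longrightarrow> Z $$ (i, j) \<noteq> 0 \<Longrightarrow> p (Row i) = p (Col j)"
    and "u \<in> nodes Z" "v \<in> nodes Z"
  shows "p u = p v"
proof -
  have "(u, v) \<in> (edges Z)\<^sup>*"
    using assms by (auto simp: connected_mat_def same_component_def)
  then show ?thesis
  proof induction
    case (step v w)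
    then show ?case using edge by (auto simp: edges_iff)
  qed simp
qed

section \<open>The maximal matrix of the generalized Jacobian\<close>

lemma max_jacobian_carrier: "max_jacobian n Xh y \<in> carrier_mat (2 * n - 1) (2 * n - 1)"
  unfolding max_jacobian_def using constr_mat_carrier[of n] by auto

lemma max_mask_sign_mask:
  assumes n: "n \<ge> 1" and X: "Xh \<in> carrier_mat n n" and y: "y \<in> carrier_vec (2 * n - 1)"
  shows "sign_mask (\<lambda>k. vec_stack (max_mask n Xh y) $ k) (affine_vec n Xh y)"
  unfolding sign_mask_def
proof (intro allI impI)
  fix k assume "k < dim_vec (affine_vec n Xh y)"
  then have k: "k < n * n" using affine_vec_carrier[OF X, of y] by simp
  then have "k div n < n" "k mod n < n" using n by (auto simp: less_mult_imp_div_less)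
  then show "vec_stack (max_mask n Xh y) $ k = 1 \<and> 0 \<le> affine_vec n Xh y $ k \<or>
      vec_stack (max_mask n Xh y) $ k = 0 \<and> affine_vec n Xh y $ k \<le> 0"
    using k
    by (auto simp: affine_vec_index[OF n X y] vec_stack_def max_mask_index)
qed

text \<open>If \<open>V v = 0\<close> then \<open>0 = \<langle>v, V v\<rangle>\<close> is the sum over the edges of the mask of the squares
  \<open>(v\<^sub>j + r\<^sub>i)\<^sup>2\<close>, where \<open>r\<^sub>i\<close> is the row multiplier of \<open>v\<close>. So \<open>v\<^sub>j = - r\<^sub>i\<close> along every edge, and the potential with
  values \<open>v\<^sub>j\<close> on columns and \<open>- r\<^sub>i\<close> on rows is constant on the connected graph. It vanishes at the last row.\<close>

lemma max_jacobian_nonsingular: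
  assumes n: "n \<ge> 1" and X: "Xh \<in> carrier_mat n n" and conn: "connected_mat (max_mask n Xh y)"
  shows "\<exists>W\<in>carrier_mat (2 * n - 1) (2 * n - 1).
    inverts_mat (max_jacobian n Xh y) W \<and> inverts_mat W (max_jacobian n Xh y)"
proof (rule real_mat_invertible_if_kernel_trivial[OF max_jacobian_carrier])
  fix v assume v: "v \<in> carrier_vec (2 * n - 1)" and Vv: "max_jacobian n Xh y *\<^sub>v v = 0\<^sub>v (2 * n - 1)"
  let ?A = "constr_mat n" and ?M = "max_mask n Xh y"
  define d where "d = (\<lambda>k. vec_stack ?M $ k)"
  define Dg where "Dg = mat_diag (n * n) d"
  have A: "?A \<in> carrier_mat (2 * n - 1) (n * n)" by (rule constr_mat_carrier)
  have D: "Dg \<in> carrier_mat (n * n) (n * n)" by (simp add: Dg_def)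
  define q where "q = ?A\<^sup>T *\<^sub>v v"
  have q: "q \<in> carrier_vec (n * n)" unfolding q_def using A by (intro carrier_vecI) simp
  have AT: "?A\<^sup>T \<in> carrier_mat (n * n) (2 * n - 1)" using A by simp
  have "?A *\<^sub>v (Dg *\<^sub>v q) = 0\<^sub>v (2 * n - 1)"
    using Vv assoc_mult_mat_vec[OF mult_carrier_mat[OF A D] AT v] assoc_mult_mat_vec[OF A D q]
    unfolding max_jacobian_def q_def Dg_def d_def by simp
  moreover have "q \<bullet> (Dg *\<^sub>v q) = v \<bullet> (?A *\<^sub>v (Dg *\<^sub>v q))"
    unfolding q_def by (rule transpose_vec_mult_scalar[OF A]) (use D q v q_def in auto)
  ultimately have "q \<bullet> (Dg *\<^sub>v q) = 0" using v by simp
  moreover have "q \<bullet> (Dg *\<^sub>v q) = (\<Sum>k<n * n. d k * (q $ k)\<^sup>2)"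
    unfolding Dg_def mat_diag_mult_vec[OF q]
    by (simp add: scalar_prod_def atLeast0LessThan power2_eq_square algebra_simps)
  moreover have d01: "d k = 0 \<or> d k = 1" if "k < n * n" for k
  proof -
    have "k div n < n" "k mod n < n" using that n by (auto simp: less_mult_imp_div_less)
    then show ?thesis using that by (auto simp: d_def vec_stack_def max_mask_index)
  qed
  ultimately have zero: "\<forall>k\<in>{..<n * n}. d k * (q $ k)\<^sup>2 = 0"
    by (subst sum_nonneg_eq_0_iff[symmetric]) (auto, metis mult_zero_left mult_1 order_refl zero_le_power2)
  define p where "p = (\<lambda>u. case u of Row i \<Rightarrow> - row_mult n v i | Col j \<Rightarrow> v $ j)"
  have dims: "dim_row ?M = n" "dim_col ?M = n" by simp_all
  have edge: "p (Row i) = p (Col j)" if ij: "i < n" "j < n" and "?M $$ (i, j) \<noteq> 0" for i j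
  proof -
    have k: "j * n + i < n * n" using ij by (rule index_pair_less)
    have "d (j * n + i) = ?M $$ (i, j)" using k ij dims by (simp add: d_def vec_stack_def)
    then have "q $ (j * n + i) = 0" using bspec[OF zero, of "j * n + i"] k that by simp
    then show ?thesis
      using constr_mat_transpose_mult[OF n v k] ij by (simp add: q_def p_def)
  qed
  have p0: "p u = 0" if "u \<in> nodes ?M" for u
  proof -
    have "p u = p (Row (n - 1))"
      by (rule connected_mat_potential[OF conn _ that]) (use edge dims n in \<open>auto simp: nodes_def\<close>)
    then show ?thesis by (simp add: p_def row_mult_def)
  qed
  show "v = 0\<^sub>v (2 * n - 1)"
  proof (rule eq_vecI)
    fix r assume "r < dim_vec (0\<^sub>v (2 * n - 1) :: real vec)"
    then have r: "r < 2 * n - 1" by simp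
    show "v $ r = 0\<^sub>v (2 * n - 1) $ r"
    proof (cases "r < n")
      case True
      then show ?thesis using p0[of "Col r"] dims r by (simp add: p_def nodes_def)
    next
      case False
      then show ?thesis using p0[of "Row (r - n)"] dims r
        by (auto simp: p_def nodes_def row_mult_def split: if_splits)
    qed
  qed (use v in auto)
qed

section \<open>The shifting procedure\<close>

lemma Ymat_shift:
  assumes n: "n \<ge> 1" and X: "Xh \<in> carrier_mat n n" and y: "y \<in> carrier_vec (2 * n - 1)"
    and last: "n - 1 \<notin> Rbar" and i: "i < n" and j: "j < n"
  shows "Ymat n Xh (y + t \<cdot>\<^sub>v shift_direction n Rbar Cbar) $$ (i, j) =
    Ymat n Xh y $$ (i, j) + t * (of_bool (j \<in> Cbar) - of_bool (i \<in> Rbar))"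
proof -
  have "y + t \<cdot>\<^sub>v shift_direction n Rbar Cbar \<in> carrier_vec (2 * n - 1)"
    using y by (auto simp: shift_direction_def)
  moreover have "\<not> i < n - 1 \<Longrightarrow> i = n - 1" using i by auto
  ultimately show ?thesis
    using assms by (auto simp: Ymat_index row_mult_def shift_direction_def algebra_simps)
qed

text \<open>All entries touched by a shift are negative, and \<open>t\<close> is, for its sign, the largest
  shift that keeps them nonpositive: one of the two submatrices moves up until its largest entry is zero while the other one moves
  down. The positive part is unchanged, and the new zero enlarges the set of nonnegative entries.\<close>

lemma shift_step_keeps_class_grows_mask:
  assumes n: "n \<ge> 1" and X: "Xh \<in> carrier_mat n n" and y: "y \<in> carrier_vec (2 * n - 1)"
    and step: "shift_step n Xh y y'"
  shows "y' \<in> eq_class n Xh y"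
    and "{ij \<in> {..<n} \<times> {..<n}. Ymat n Xh y $$ ij \<ge> 0} \<subset>
      {ij \<in> {..<n} \<times> {..<n}. Ymat n Xh y' $$ ij \<ge> 0}"
proof -
  let ?S = "\<lambda>y. {ij \<in> {..<n} \<times> {..<n}. Ymat n Xh y $$ ij \<ge> 0}"
  define Y where "Y = Ymat n Xh y"
  obtain B t R C Rbar Cbar where adm: "admissible_blocks n Xh y B"
    and R: "R = block_rows B" and C: "C = block_cols B"
    and Rbar: "Rbar = {..<n} - R" and Cbar: "Cbar = {..<n} - C"
    and t: "R \<times> Cbar \<noteq> {} \<and> t = - Max ((\<lambda>ij. Y $$ ij) ` (R \<times> Cbar)) \<or>
            Rbar \<times> C \<noteq> {} \<and> t = Max ((\<lambda>ij. Y $$ ij) ` (Rbar \<times> C))"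
    and y'_def: "y' = y + t \<cdot>\<^sub>v shift_direction n Rbar Cbar"
    using step unfolding shift_step_def Let_def Y_def by blast
  have sub: "B \<subset> blocks (pos_mat Y)" and last: "\<exists>b\<in>B. Row (n - 1) \<in> b"
    and neg1: "\<And>i j. i \<in> R \<Longrightarrow> j \<in> Cbar \<Longrightarrow> Y $$ (i, j) < 0"
    and neg2: "\<And>i j. i \<in> Rbar \<Longrightarrow> j \<in> C \<Longrightarrow> Y $$ (i, j) < 0"
    using adm unfolding admissible_blocks_def Let_def Y_def R C Rbar Cbar by auto
  have "\<Union>B \<subseteq> nodes (pos_mat Y)"
    using sub Union_quotient[OF same_component_equiv[of "pos_mat Y"]] unfolding blocks_def by blast
  then have Rn: "R \<subseteq> {..<n}" and Cn: "C \<subseteq> {..<n}"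
    by (auto simp: R C block_rows_def block_cols_def nodes_def pos_mat_def Y_def)
  have lastR: "n - 1 \<notin> Rbar" using last by (auto simp: Rbar R block_rows_def)
  have y'c: "y' \<in> carrier_vec (2 * n - 1)"
    using y by (auto simp: y'_def shift_direction_def)
  have Y': "Ymat n Xh y' $$ (i, j) = Y $$ (i, j) + t * (of_bool (j \<in> Cbar) - of_bool (i \<in> Rbar))"
    if "i < n" "j < n" for i j
    unfolding y'_def Y_def by (rule Ymat_shift[OF n X y lastR that])
  have fin: "finite (R \<times> Cbar)" "finite (Rbar \<times> C)"
    using Rn Cn finite_subset[of _ "{..<n}"] by (auto simp: Rbar Cbar)
  have cross: "(\<forall>i\<in>R. \<forall>j\<in>Cbar. Y $$ (i, j) + t \<le> 0) \<and> (\<forall>i\<in>Rbar. \<forall>j\<in>C. Y $$ (i, j) - t \<le> 0)"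
    using t
  proof (elim disjE conjE)
    assume ne: "R \<times> Cbar \<noteq> {}" and tt: "t = - Max ((\<lambda>ij. Y $$ ij) ` (R \<times> Cbar))"
    have "Y $$ (i, j) \<le> - t" if "i \<in> R" "j \<in> Cbar" for i j
      unfolding tt using fin that by (auto intro!: Max_ge)
    moreover have "t > 0"
      unfolding tt using fin ne neg1 by (subst neg_0_less_iff_less, subst Max_less_iff) auto
    ultimately show ?thesis
      using neg2 by (smt (verit, best))
  next
    assume ne: "Rbar \<times> C \<noteq> {}" and tt: "t = Max ((\<lambda>ij. Y $$ ij) ` (Rbar \<times> C))"
    have "Y $$ (i, j) \<le> t" if "i \<in> Rbar" "j \<in> C" for i j
      unfolding tt using fin that by (auto intro!: Max_ge)
    moreover have "t < 0"
      unfolding tt using fin ne neg2 by (subst Max_less_iff) auto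
    ultimately show ?thesis
      using neg1 by (smt (verit, best))
  qed
  have Y'_cases: "Y $$ (i, j) < 0 \<and> Ymat n Xh y' $$ (i, j) \<le> 0 \<or> Ymat n Xh y' $$ (i, j) = Y $$ (i, j)"
    if ij: "i < n" "j < n" for i j
  proof -
    consider "i \<in> R" "j \<in> Cbar" | "i \<in> Rbar" "j \<in> C" | "i \<in> R \<longleftrightarrow> j \<in> C"
      using ij by (auto simp: Rbar Cbar)
    then show ?thesis
      using cross neg1[of i j] neg2[of i j] Y'[OF ij] ij by cases (auto simp: Rbar Cbar)
  qed
  show "y' \<in> eq_class n Xh y"
  proof -
    have "max (Ymat n Xh y' $$ (i, j)) 0 = max (Ymat n Xh y $$ (i, j)) 0" if "i < n" "j < n" for i j
      using Y'_cases[OF that] by (auto simp: Y_def)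
    then show ?thesis
      unfolding eq_class_def using y'c pos_vec_affine_eqI[OF n X y'c y] by blast
  qed
  have new: "\<exists>i<n. \<exists>j<n. Y $$ (i, j) < 0 \<and> Ymat n Xh y' $$ (i, j) = 0"
    using t
  proof (elim disjE conjE)
    assume ne: "R \<times> Cbar \<noteq> {}" and tt: "t = - Max ((\<lambda>ij. Y $$ ij) ` (R \<times> Cbar))"
    have "Max ((\<lambda>ij. Y $$ ij) ` (R \<times> Cbar)) \<in> (\<lambda>ij. Y $$ ij) ` (R \<times> Cbar)"
      using ne fin by (intro Max_in) auto
    then obtain i j where ij: "i \<in> R" "j \<in> Cbar" "Y $$ (i, j) = - t" using tt by auto
    then have "i < n" "j < n" using Rn by (auto simp: Cbar)
    moreover have "Y $$ (i, j) < 0" "Ymat n Xh y' $$ (i, j) = 0"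
      using ij Y'[OF calculation] neg1[of i j] by (auto simp: Rbar)
    ultimately show ?thesis by blast
  next
    assume ne: "Rbar \<times> C \<noteq> {}" and tt: "t = Max ((\<lambda>ij. Y $$ ij) ` (Rbar \<times> C))"
    have "Max ((\<lambda>ij. Y $$ ij) ` (Rbar \<times> C)) \<in> (\<lambda>ij. Y $$ ij) ` (Rbar \<times> C)"
      using ne fin by (intro Max_in) auto
    then obtain i j where ij: "i \<in> Rbar" "j \<in> C" "Y $$ (i, j) = t" using tt by auto
    then have "i < n" "j < n" using Cn by (auto simp: Rbar)
    moreover have "Y $$ (i, j) < 0" "Ymat n Xh y' $$ (i, j) = 0"
      using ij Y'[OF calculation] neg2[of i j] by (auto simp: Cbar)
    ultimately show ?thesis by blast
  qed
  have "Ymat n Xh y' $$ (i, j) \<ge> 0" if "i < n" "j < n" "Y $$ (i, j) \<ge> 0" for i j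
    using Y'_cases[OF that(1,2)] that(3) by auto
  then have "?S y \<subseteq> ?S y'" by (auto simp: Y_def)
  moreover have "\<exists>i j. (i, j) \<in> ?S y' \<and> (i, j) \<notin> ?S y"
  proof -
    obtain i j where "i < n" "j < n" "Y $$ (i, j) < 0" "Ymat n Xh y' $$ (i, j) = 0"
      using new by blast
    then have "(i, j) \<in> ?S y' \<and> (i, j) \<notin> ?S y" by (simp add: Y_def)
    then show ?thesis by blast
  qed
  ultimately show "?S y \<subset> ?S y'"
    by blast
qed

text \<open>Every entry between the component \<open>K\<close> of the last row in the graph of the maximal mask and its
  complement is negative. Positive entries belong to the mask, so \<open>K\<close> is a union of blocks of
  the positive part, and these blocks can serve as \<open>B\<close>.\<close>

lemma shift_step_exists:
  assumes n: "n \<ge> 1" and disc: "\<not> connected_mat (max_mask n Xh y)"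
  shows "\<exists>y'. shift_step n Xh y y'"
proof -
  define Y where "Y = Ymat n Xh y"
  define M where "M = max_mask n Xh y"
  define P where "P = pos_mat Y"
  have dims: "dim_row Y = n" "dim_col Y = n" "dim_row M = n" "dim_col M = n" "dim_row P = n" "dim_col P = n"
    by (auto simp: Y_def M_def P_def pos_mat_def)
  have nodes: "nodes P = nodes M" by (simp add: nodes_def dims)
  have edges: "edges P \<subseteq> edges M"
  proof
    fix uv assume "uv \<in> edges P"
    moreover obtain u v where uv: "uv = (u, v)" by (cases uv)
    ultimately obtain i j where ij: "i < n" "j < n" "P $$ (i, j) \<noteq> 0"
      "u = Row i \<and> v = Col j \<or> u = Col j \<and> v = Row i"
      by (auto simp: edges_iff dims)
    then have "Y $$ (i, j) > 0" using dims by (auto simp: P_def pos_mat_def max_def split: if_splits)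
    then have "M $$ (i, j) \<noteq> 0" using ij by (simp add: M_def max_mask_index Y_def)
    then show "uv \<in> edges M" using ij unfolding uv edges_iff dims by blast
  qed
  note compsub = same_component_mono[OF edges nodes]
  note eqP = same_component_equiv[of P] and eqM = same_component_equiv[of M]
  let ?last = "Row (n - 1)"
  have last: "?last \<in> nodes M" using n by (auto simp: nodes_def dims)
  define K where "K = same_component M `` {?last}"
  define B where "B = {b \<in> blocks P. b \<subseteq> K}"
  have blk: "same_component P `` {v} \<in> B" if "v \<in> K" for v
  proof -
    have v: "v \<in> nodes P" "(?last, v) \<in> same_component M"
      using that nodes by (auto simp: K_def same_component_def)
    have "same_component P `` {v} \<subseteq> K"
      using compsub v eqM unfolding K_def equiv_def trans_def by blast
    then show ?thesis using v by (auto simp: B_def blocks_def quotientI)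
  qed
  have UB: "\<Union>B = K"
  proof
    show "K \<subseteq> \<Union>B"
    proof
      fix v assume v: "v \<in> K"
      then have "v \<in> nodes P" using nodes by (auto simp: K_def same_component_def)
      then show "v \<in> \<Union>B" using blk[OF v] equiv_class_self[OF eqP] by blast
    qed
  qed (auto simp: B_def)
  obtain w where w: "w \<in> nodes M" "w \<notin> K"
  proof -
    obtain a b where ab: "a \<in> nodes M" "b \<in> nodes M" "(a, b) \<notin> same_component M"
      using disc unfolding connected_mat_def M_def[symmetric] by blast
    then have "a \<notin> K \<or> b \<notin> K"
      using eqM unfolding K_def equiv_def trans_def sym_def by blast
    then show thesis using ab that by blast
  qed
  have Blast: "\<exists>b\<in>B. ?last \<in> b"
    using UB equiv_class_self[OF eqM last] unfolding K_def by blast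
  have Bsub: "B \<subset> blocks P"
  proof
    show "B \<subseteq> blocks P" by (auto simp: B_def)
    have "\<Union>(blocks P) = nodes M"
      unfolding blocks_def nodes[symmetric] by (rule Union_quotient[OF eqP])
    then show "B \<noteq> blocks P" using UB w by blast
  qed
  let ?R = "block_rows B" and ?C = "block_cols B"
  have R: "i \<in> ?R \<longleftrightarrow> Row i \<in> K" and C: "i \<in> ?C \<longleftrightarrow> Col i \<in> K" for i
    unfolding block_rows_def block_cols_def UB by auto
  have Kn: "Row i \<in> K \<Longrightarrow> i < n" "Col i \<in> K \<Longrightarrow> i < n" for i
    by (auto simp: K_def same_component_def nodes_def dims)
  have Kedge: "Row i \<in> K \<longleftrightarrow> Col j \<in> K" if "i < n" "j < n" "\<not> Y $$ (i, j) < 0" for i j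
  proof -
    have "M $$ (i, j) \<noteq> 0" using that by (simp add: M_def max_mask_index Y_def)
    then have "(Row i, Col j) \<in> edges M" "(Col j, Row i) \<in> edges M"
      using that by (auto simp: edges_iff dims)
    moreover have "Row i \<in> nodes M" "Col j \<in> nodes M"
      using that by (auto simp: nodes_def dims)
    ultimately show ?thesis
      unfolding K_def same_component_def by (auto intro: rtrancl_into_rtrancl)
  qed
  have adm: "admissible_blocks n Xh y B"
    unfolding admissible_blocks_def Let_def Y_def[symmetric] P_def[symmetric]
  proof (intro conjI ballI)
    fix i j assume "i \<in> ?R" "j \<in> {..<n} - ?C"
    then show "Y $$ (i, j) < 0" using Kedge[of i j] Kn(1)[of i] by (auto simp: R C)
  next
    fix i j assume "i \<in> {..<n} - ?R" "j \<in> ?C"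
    then show "Y $$ (i, j) < 0" using Kedge[of i j] Kn(2)[of j] by (auto simp: R C)
  qed (use Bsub Blast in auto)
  \<comment> \<open>The last row is in \<open>K\<close> and \<open>w\<close> is not: if no column is missing from \<open>K\<close>, then a row is missing, and
    \<open>K\<close> contains a column because \<open>n \<ge> 1\<close>.\<close>
  have "?R \<times> ({..<n} - ?C) \<noteq> {} \<or> ({..<n} - ?R) \<times> ?C \<noteq> {}"
  proof (rule ccontr)
    assume "\<not> ?thesis"
    moreover have "n - 1 \<in> ?R" using equiv_class_self[OF eqM last] by (simp add: R K_def)
    ultimately have all: "{..<n} - ?C = {}" "{..<n} - ?R = {} \<or> ?C = {}" by auto
    then have "n - 1 \<in> ?C" using n by (auto simp: subset_iff)
    with all show False using w by (auto simp: nodes_def dims R C)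
  qed
  then show ?thesis
    using disc adm unfolding shift_step_def Let_def by blast
qed

lemma shift_step_carrier:
  assumes "y \<in> carrier_vec (2 * n - 1)" "shift_step n Xh y y'"
  shows "y' \<in> carrier_vec (2 * n - 1)"
  using assms by (auto simp: shift_step_def Let_def shift_direction_def)

lemma shifting_terminates_always:
  assumes n: "n \<ge> 1" and X: "Xh \<in> carrier_mat n n" and y: "y \<in> carrier_vec (2 * n - 1)"
  shows "shifting_terminates n Xh y"
  using y
proof (induction "n * n - card {ij \<in> {..<n} \<times> {..<n}. Ymat n Xh y $$ ij \<ge> 0}" arbitrary: y rule: less_induct)
  case less
  let ?S = "\<lambda>y. {ij \<in> {..<n} \<times> {..<n}. Ymat n Xh y $$ ij \<ge> 0}"
  show ?case
  proof (cases "connected_mat (max_mask n Xh y)")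
    case True
    then show ?thesis by (rule shifting_terminates.stop)
  next
    case False
    show ?thesis
    proof (rule shifting_terminates.step[OF shift_step_exists[OF n False]])
      fix y' assume st: "shift_step n Xh y y'"
      have "card (?S y) < card (?S y')"
        by (intro psubset_card_mono shift_step_keeps_class_grows_mask(2)[OF n X less.prems st]) simp
      moreover have "card (?S y') \<le> card ({..<n} \<times> {..<n})"
        by (rule card_mono) auto
      ultimately show "shifting_terminates n Xh y'"
        by (intro less.hyps shift_step_carrier[OF less.prems st]) simp
    qed
  qed
qed

lemma shifting_result_eq_class:
  assumes n: "n \<ge> 1" and X: "Xh \<in> carrier_mat n n" and y: "y \<in> carrier_vec (2 * n - 1)"
    and "shifting_result n Xh y z"
  shows "z \<in> eq_class n Xh y"
proof -
  have "(shift_step n Xh)\<^sup>*\<^sup>* y z" using assms by (simp add: shifting_result_def)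
  then show ?thesis
  proof induction
    case base
    then show ?case using y by (simp add: eq_class_def)
  next
    case (step z z')
    then have "z \<in> carrier_vec (2 * n - 1)" by (simp add: eq_class_def)
    from shift_step_keeps_class_grows_mask(1)[OF n X this step.hyps(2)] step.IH
    show ?case by (simp add: eq_class_def)
  qed
qed

section \<open>Local convergence of the Newton method\<close>

lemma residual_pw: "residual n Xh y = pw_residual (constr_mat n) (vec_stack Xh) (rhs_vec n) y"
  by (simp add: residual_def pw_residual_def affine_vec_def)

lemma finite_max_masks: "finite (range (max_mask n Xh))"
proof (rule finite_subset)
  show "range (max_mask n Xh) \<subseteq>
      (\<lambda>S. mat n n (\<lambda>ij. if ij \<in> S then 1 else 0)) ` Pow ({..<n} \<times> {..<n})"
  proof clarify
    fix y
    show "max_mask n Xh y \<in> (\<lambda>S. mat n n (\<lambda>ij. if ij \<in> S then 1 else 0)) ` Pow ({..<n} \<times> {..<n})"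
      by (rule image_eqI[of _ _ "{ij \<in> {..<n} \<times> {..<n}. Ymat n Xh y $$ ij \<ge> 0}"])
        (auto simp: max_mask_def intro!: cong_mat)
  qed
qed simp

text \<open>Each maximal mask has its own threshold for the residual; there are only finitely many masks, so one
  threshold serves all of them. The threshold is compared with the residual at \<open>y\<close> itself, because the
  shifting procedure stays in the class of \<open>y\<close>, on which the residual is constant.\<close>

lemma newton_step_exact:
  assumes n: "n \<ge> 1" and X: "Xh \<in> carrier_mat n n"
  obtains \<epsilon> where "\<epsilon> > 0"
    "\<And>y y'. y \<in> carrier_vec (2 * n - 1) \<Longrightarrow>
       (\<And>k. k < 2 * n - 1 \<Longrightarrow> \<bar>residual n Xh y $ k\<bar> < \<epsilon>) \<Longrightarrow> newton_step n Xh y y' \<Longrightarrow>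
       y' \<in> carrier_vec (2 * n - 1) \<and> residual n Xh y' = 0\<^sub>v (2 * n - 1)"
proof -
  let ?m = "2 * n - 1"
  have A: "constr_mat n \<in> carrier_mat ?m (n * n)" by (rule constr_mat_carrier)
  have x: "vec_stack Xh \<in> carrier_vec (n * n)" using X by (auto simp: vec_stack_def)
  have b: "rhs_vec n \<in> carrier_vec ?m" by (simp add: rhs_vec_def)
  define good where "good M \<epsilon> \<longleftrightarrow> (\<forall>z W. z \<in> carrier_vec ?m \<longrightarrow> max_mask n Xh z = M \<longrightarrow>
      inverts_mat (max_jacobian n Xh z) W \<longrightarrow> inverts_mat W (max_jacobian n Xh z) \<longrightarrow>
      (\<forall>k<?m. \<bar>residual n Xh z $ k\<bar> < \<epsilon>) \<longrightarrow>
      residual n Xh (z - W *\<^sub>v residual n Xh z) = 0\<^sub>v ?m)" for M and \<epsilon> :: real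
  have ex: "\<exists>\<epsilon>>0. good M \<epsilon>" for M
  proof -
    define V where "V = constr_mat n * mat_diag (n * n) (\<lambda>k. vec_stack M $ k) * (constr_mat n)\<^sup>T"
    obtain \<epsilon> where e: "\<epsilon> > 0" and
      "\<And>z W. z \<in> carrier_vec ?m \<Longrightarrow> sign_mask (\<lambda>k. vec_stack M $ k) (vec_stack Xh + (constr_mat n)\<^sup>T *\<^sub>v z) \<Longrightarrow>
       inverts_mat V W \<Longrightarrow> inverts_mat W V \<Longrightarrow>
       (\<And>k. k < ?m \<Longrightarrow> \<bar>pw_residual (constr_mat n) (vec_stack Xh) (rhs_vec n) z $ k\<bar> < \<epsilon>) \<Longrightarrow>
       pw_residual (constr_mat n) (vec_stack Xh) (rhs_vec n)
         (z - W *\<^sub>v pw_residual (constr_mat n) (vec_stack Xh) (rhs_vec n) z) = 0\<^sub>v ?m"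
      using newton_step_exact_near_zero[OF A x b V_def] by blast
    then have "good M \<epsilon>"
      unfolding good_def residual_pw[symmetric] V_def affine_vec_def[symmetric]
      using max_mask_sign_mask[OF n X] by (auto simp: max_jacobian_def)
    with e show ?thesis by blast
  qed
  then obtain f where f: "\<And>M. f M > 0" "\<And>M. good M (f M)" by metis
  define \<epsilon> where "\<epsilon> = Min (f ` range (max_mask n Xh))"
  have fin: "finite (f ` range (max_mask n Xh))" using finite_max_masks by simp
  have e: "\<epsilon> > 0" unfolding \<epsilon>_def using fin f(1) by (subst Min_gr_iff) auto
  have le: "\<epsilon> \<le> f (max_mask n Xh z)" for z unfolding \<epsilon>_def using fin by (intro Min_le) auto
  show thesis
  proof (rule that[OF e])
    fix y y' assume y: "y \<in> carrier_vec ?m" and small: "\<And>k. k < ?m \<Longrightarrow> \<bar>residual n Xh y $ k\<bar> < \<epsilon>"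
      and "newton_step n Xh y y'"
    then obtain z W where sr: "shifting_result n Xh y z"
      and W: "inverts_mat (max_jacobian n Xh z) W" "inverts_mat W (max_jacobian n Xh z)"
      and y': "y' = z - W *\<^sub>v residual n Xh z"
      by (auto simp: newton_step_def)
    have zc: "z \<in> eq_class n Xh y" by (rule shifting_result_eq_class[OF n X y sr])
    then have z: "z \<in> carrier_vec ?m" and rz: "residual n Xh z = residual n Xh y"
      by (simp_all add: eq_class_def residual_def)
    have "\<forall>k<?m. \<bar>residual n Xh z $ k\<bar> < f (max_mask n Xh z)"
      unfolding rz using small le[of z] by fastforce
    then have "residual n Xh y' = 0\<^sub>v ?m"
      using f(2)[of "max_mask n Xh z"] z W unfolding good_def y' by blast
    moreover have "y' \<in> carrier_vec ?m"
      unfolding y' using inverts_mat_carrier[OF max_jacobian_carrier W] z by (intro carrier_vecI) simp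
    ultimately show "y' \<in> carrier_vec ?m \<and> residual n Xh y' = 0\<^sub>v ?m" by blast
  qed
qed

theorem theorem3p17:
  assumes "n \<ge> 1"
    and "Xh \<in> carrier_mat n n"
    and "ystar \<in> carrier_vec (2 * n - 1)"
    and "residual n Xh ystar = 0\<^sub>v (2 * n - 1)"
  shows "\<exists>\<delta>>0. \<forall>y0\<in>carrier_vec (2 * n - 1).
    dist_set y0 (eq_class n Xh ystar) < \<delta> \<longrightarrow>
      newton_well_defined n Xh y0 \<and>
      (\<forall>ys. ys 0 = y0 \<and> newton_sequence n Xh ys \<longrightarrow>
        (\<exists>ybar\<in>eq_class n Xh ystar. q_quadratic n Xh ys ybar))"
proof -
  let ?m = "2 * n - 1" and ?S = "eq_class n Xh ystar"
  note n = assms(1) and X = assms(2) and ystar = assms(3) and zero = assms(4)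
  have A: "constr_mat n \<in> carrier_mat ?m (n * n)" by (rule constr_mat_carrier)
  have x: "vec_stack Xh \<in> carrier_vec (n * n)" using X by (auto simp: vec_stack_def)
  have b: "rhs_vec n \<in> carrier_vec ?m" by (simp add: rhs_vec_def)
  have solution: "y \<in> ?S" if "y \<in> carrier_vec ?m" "residual n Xh y = 0\<^sub>v ?m" for y
    using pos_vec_eq_if_pw_residual_zero[OF A x b that(1) ystar] that zero
    by (simp add: residual_pw eq_class_def affine_vec_def)
  obtain \<epsilon> where \<epsilon>: "\<epsilon> > 0" and exact: "\<And>y y'. y \<in> carrier_vec ?m \<Longrightarrow>
       (\<And>k. k < ?m \<Longrightarrow> \<bar>residual n Xh y $ k\<bar> < \<epsilon>) \<Longrightarrow> newton_step n Xh y y' \<Longrightarrow>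
       y' \<in> carrier_vec ?m \<and> residual n Xh y' = 0\<^sub>v ?m"
    using newton_step_exact[OF n X] by blast
  obtain L where L: "L > 0" and lip: "\<And>y s e k. y \<in> carrier_vec ?m \<Longrightarrow> s \<in> carrier_vec ?m \<Longrightarrow>
       vec_norm2 (y - s) \<le> e \<Longrightarrow> k < ?m \<Longrightarrow> \<bar>residual n Xh y $ k - residual n Xh s $ k\<bar> \<le> L * e"
    using pw_residual_lipschitz[OF A x b] unfolding residual_pw by blast
  show ?thesis
  proof (intro exI[of _ "\<epsilon> / (2 * L)"] conjI ballI impI allI)
    show "\<epsilon> / (2 * L) > 0" using \<epsilon> L by simp
    fix y0 assume y0: "y0 \<in> carrier_vec ?m" and near: "dist_set y0 ?S < \<epsilon> / (2 * L)"
    have "ystar \<in> ?S" using ystar by (simp add: eq_class_def)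
    moreover have "bdd_below ((\<lambda>s. vec_norm2 (y0 - s)) ` ?S)"
      by (rule bdd_belowI2[of _ 0]) (simp add: vec_norm2_def)
    ultimately obtain s where s: "s \<in> ?S" and ds: "vec_norm2 (y0 - s) < \<epsilon> / (2 * L)"
      using near cINF_less_iff[of ?S "\<lambda>s. vec_norm2 (y0 - s)"] unfolding dist_set_def by blast
    have sc: "s \<in> carrier_vec ?m" and rs: "residual n Xh s = 0\<^sub>v ?m"
      using s zero by (auto simp: eq_class_def residual_def)
    have small: "\<bar>residual n Xh y0 $ k\<bar> < \<epsilon>" if "k < ?m" for k
      using lip[OF y0 sc less_imp_le[OF ds] that] rs that \<epsilon> L by simp
    have onestep: "y' \<in> carrier_vec ?m \<and> residual n Xh y' = 0\<^sub>v ?m" if "newton_step n Xh y0 y'" for y'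
      using exact[OF y0 small that] .
    show "newton_well_defined n Xh y0"
      unfolding newton_well_defined_def
    proof (intro allI impI, elim conjE)
      fix y assume reach: "(newton_step n Xh)\<^sup>*\<^sup>* y0 y" and nz: "residual n Xh y \<noteq> 0\<^sub>v ?m"
      have "y = y0 \<or> residual n Xh y = 0\<^sub>v ?m"
        using reach
      proof induction
        case (step y y')
        then have "y = y0" by (auto simp: newton_step_def)
        then show ?case using step.hyps(2) onestep by blast
      qed simp
      then have y: "y \<in> carrier_vec ?m" using nz y0 by auto
      show "shifting_terminates n Xh y \<and>
          (\<forall>z. shifting_result n Xh y z \<longrightarrow> invertible_mat (max_jacobian n Xh z))"
      proof (intro conjI allI impI)
        show "shifting_terminates n Xh y" by (rule shifting_terminates_always[OF n X y])
        fix z assume "shifting_result n Xh y z"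
        then have "connected_mat (max_mask n Xh z)" by (simp add: shifting_result_def)
        then show "invertible_mat (max_jacobian n Xh z)"
          using max_jacobian_nonsingular[OF n X] max_jacobian_carrier[of n Xh z]
          unfolding invertible_mat_def by auto
      qed
    qed
    fix ys assume "ys 0 = y0 \<and> newton_sequence n Xh ys"
    then have ys0: "ys 0 = y0" and seq: "newton_sequence n Xh ys" by auto
    obtain k where "ys k \<in> carrier_vec ?m" "residual n Xh (ys k) = 0\<^sub>v ?m"
    proof (cases "residual n Xh y0 = 0\<^sub>v ?m")
      case True
      then show thesis using that[of 0] ys0 y0 by simp
    next
      case False
      then have "newton_step n Xh y0 (ys 1)"
        using seq ys0 unfolding newton_sequence_def by (metis One_nat_def)
      then show thesis using that[of 1] onestep by blast
    qed
    then show "\<exists>ybar\<in>?S. q_quadratic n Xh ys ybar"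
      using solution[of "ys k"] by (auto simp: q_quadratic_def)
  qed
qed

end
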